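(* Let $S\subset\mathbb{N}$ be a finite set with $|S|=n\ge 5$. Then Maker does not have an $n$-move strategy in the game for $S$.
   Context: Game for $S$: for a fixed finite set $S\subset\mathbb{N}$, two players, Maker and Breaker, alternately choose previously unchosen natural numbers, Maker choosing first. Maker wins as soon as the set of Maker's choices contains $aS+b$ for some $a\in\mathbb{N}\setminus\{0\}$ and $b\in\mathbb{Z}$. Maker has an $N$-move strategy if Maker has a strategy guaranteeing a win using at most $N$ selections, whatever Breaker does. *)

theory Defs
  imports Main
begin

definition homothetic_copy :: "nat set \<Rightarrow> nat \<Rightarrow> int \<Rightarrow> int set" where
  "homothetic_copy S a b = (\<lambda>s. int a * int s + b) ` S"

definition contains_copy :: "nat set \<Rightarrow> nat set \<Rightarrow> bool" where
  "contains_copy S M \<longleftrightarrow> (\<exists>a b. a \<noteq> 0 \<and> homothetic_copy S a b \<subseteq> int ` M)"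

text \<open>
  A play is the sequence of all choices in chronological order: \<open>p (2 * k)\<close> is the choice of
  Maker in round \<open>k\<close> and \<open>p (2 * k + 1)\<close> the reply of Breaker (rounds are counted from 0).
  Choices have to be previously unchosen, so a play is injective. Plays are infinite, i.e. they
  are formally continued after Maker has won; this does not affect whether Maker has won within
  a given number of selections, since the set of Maker's choices only grows, and every finite
  legal sequence of choices can be continued.
\<close>

definition legal_play :: "(nat \<Rightarrow> nat) \<Rightarrow> bool" where
  "legal_play p \<longleftrightarrow> (\<forall>i. p i \<notin> p ` {..<i})"

definition maker_choices :: "(nat \<Rightarrow> nat) \<Rightarrow> nat \<Rightarrow> nat set" where
  "maker_choices p N = (\<lambda>k. p (2 * k)) ` {..<N}"

text \<open>
  A strategy maps the list of all choices made so far (by both players, in chronological order)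
  to Maker's next choice. Requiring an unchosen number for every list, and not only for those
  that can occur, is harmless: infinitely many numbers are always available.
\<close>

definition maker_strategy :: "(nat list \<Rightarrow> nat) \<Rightarrow> bool" where
  "maker_strategy \<sigma> \<longleftrightarrow> (\<forall>h. \<sigma> h \<notin> set h)"

definition follows :: "(nat list \<Rightarrow> nat) \<Rightarrow> (nat \<Rightarrow> nat) \<Rightarrow> bool" where
  "follows \<sigma> p \<longleftrightarrow> (\<forall>k. p (2 * k) = \<sigma> (map p [0..<2 * k]))"

definition maker_has_move_strategy :: "nat set \<Rightarrow> nat \<Rightarrow> bool" where
  "maker_has_move_strategy S N \<longleftrightarrow>
     (\<exists>\<sigma>. maker_strategy \<sigma> \<and>
          (\<forall>p. legal_play p \<and> follows \<sigma> p \<longrightarrow>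
               (\<exists>m\<le>N. contains_copy S (maker_choices p m))))"

end

theory Submission
  imports Defs Complex_Main
begin

text \<open>
  To win in \<open>n = card S\<close> moves Maker may not waste a move, so Breaker only has to act after Maker's
  moves \<open>n - 2\<close> and \<open>n - 1\<close>. If \<open>n - 1\<close> points \<open>A\<close> can be completed to a copy of \<open>S\<close> in two ways, then
  a positive homothety \<open>\<psi>\<close> shifts a block \<open>s\<^sub>i, \<dots>, s\<^sub>j\<close> of the increasing enumeration of \<open>S\<close> by one
  place and fixes the at most one remaining point. As \<open>n \<ge> 5\<close>, such a block is unique; the only
  obstruction would be a golden ratio, which is irrational. The same uniqueness for the \<open>n - 1\<close>
  points of \<open>A\<close> shows the following for any \<open>n - 2\<close> points \<open>M\<close>: if \<open>M \<union> {x}\<close> and \<open>M \<union> {x'}\<close> with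
  \<open>x \<noteq> x'\<close> can both be completed in two ways, then \<open>x\<close> is one of the two completions of
  \<open>M \<union> {x'}\<close>. So after move \<open>n - 2\<close> Breaker takes such an \<open>x\<close>, and after move \<open>n - 1\<close> the at most
  one completion that is left.
\<close>

section \<open>Positive homotheties of the rational line\<close>

text \<open>Rational coefficients make these maps invertible, so that two copies of a set can be
  compared by a quotient of homotheties. Positivity of \<open>c\<close> preserves the order of
  points.\<close>

definition homothety :: "(rat \<Rightarrow> rat) \<Rightarrow> bool" where
  "homothety f \<longleftrightarrow> (\<exists>c d. 0 < c \<and> f = (\<lambda>x. c * x + d))"

lemma homothety_less_iff: "homothety f \<Longrightarrow> f x < f y \<longleftrightarrow> x < y"
  by (auto simp: homothety_def)

lemma homothety_eq_iff: "homothety f \<Longrightarrow> f x = f y \<longleftrightarrow> x = y"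
  by (auto simp: homothety_def)

lemma homothety_eqI:
  assumes "homothety f" "homothety g" "f x = g x" "f y = g y" "x \<noteq> y"
  shows "f = g"
proof -
  obtain c d c' d' where fg: "f = (\<lambda>x. c * x + d)" "g = (\<lambda>x. c' * x + d')"
    using assms by (auto simp: homothety_def)
  have "(c - c') * (x - y) = 0"
    using assms fg by (simp add: algebra_simps)
  then have "c = c'" using assms by simp
  then show ?thesis using assms fg by simp
qed

lemma homothety_factor:
  assumes "homothety t" "homothety u"
  obtains v where "homothety v" "\<And>x. t (v x) = u x"
proof -
  obtain c d c' d' where tu: "c > 0" "c' > 0" "t = (\<lambda>x. c * x + d)" "u = (\<lambda>x. c' * x + d')"
    using assms by (auto simp: homothety_def)
  let ?v = "\<lambda>x. (c' / c) * x + (d' - d) / c"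
  have "homothety ?v" unfolding homothety_def using tu by (intro exI[of _ "c' / c"] exI) auto
  moreover have "t (?v x) = u x" for x using tu by (simp add: field_simps)
  ultimately show ?thesis using that by blast
qed

text \<open>Parity: for \<open>c = p / q\<close> in lowest terms,
  \<open>p * p + p * q = q * q\<close> forces \<open>p\<close> and \<open>q\<close> both to be
  even.\<close>

lemma golden_ratio_irrational: "c * c + c \<noteq> (1 :: rat)"
proof
  assume eq: "c * c + c = 1"
  obtain p q where pq: "c = of_int p / of_int q" "q > 0" "coprime p q"
    by (metis quotient_of_div quotient_of_coprime quotient_of_denom_pos surj_pair)
  then have p: "of_int p = c * of_int q" by simp
  have "of_int (p * p + p * q) = (c * c + c) * of_int (q * q)"
    by (simp add: p algebra_simps)
  then have "(of_int (p * p + p * q) :: rat) = of_int (q * q)" by (simp only: eq mult_1)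
  then have eq': "p * p + p * q = q * q" using of_int_eq_iff by blast
  then have "even (p * p + p * q) \<longleftrightarrow> even (q * q)" by simp
  then have "even p \<and> even q" by auto
  then show False using pq(3) by (metis coprime_common_divisor odd_one)
qed

section \<open>Homotheties that shift a block of an increasing sequence\<close>

text \<open>Enumerates the indices other than \<open>i\<close> in order, so
  \<open>s \<circ> skip i\<close> is \<open>s\<close> with its term of index \<open>i\<close>
  deleted.\<close>

definition skip :: "nat \<Rightarrow> nat \<Rightarrow> nat" where
  "skip i l = (if l < i then l else Suc l)"

lemma skip_less: "l < n - 1 \<Longrightarrow> skip i l < n"
  by (auto simp: skip_def)

lemma skip_strict_mono: "l < k \<Longrightarrow> skip i l < skip i k"
  by (auto simp: skip_def)

lemma skip_image:
  assumes "i < n" shows "skip i ` {..<n - 1} = {..<n} - {i}"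
proof
  show "skip i ` {..<n - 1} \<subseteq> {..<n} - {i}" by (auto simp: skip_def)
  show "{..<n} - {i} \<subseteq> skip i ` {..<n - 1}"
  proof
    fix l assume l: "l \<in> {..<n} - {i}"
    show "l \<in> skip i ` {..<n - 1}"
    proof (cases "l < i")
      case True
      then show ?thesis using assms by (intro image_eqI[of _ _ l]) (auto simp: skip_def)
    next
      case False
      then show ?thesis using l by (intro image_eqI[of _ _ "l - 1"]) (auto simp: skip_def)
    qed
  qed
qed

definition incr :: "(nat \<Rightarrow> rat) \<Rightarrow> nat \<Rightarrow> bool" where
  "incr s n \<longleftrightarrow> (\<forall>l k. l < k \<and> k < n \<longrightarrow> s l < s k)"

lemma incr_less: "incr s n \<Longrightarrow> l < k \<Longrightarrow> k < n \<Longrightarrow> s l < s k"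
  by (simp add: incr_def)

lemma incr_eq_iff: "incr s n \<Longrightarrow> l < n \<Longrightarrow> k < n \<Longrightarrow> s l = s k \<longleftrightarrow> l = k"
  by (metis incr_less less_irrefl linorder_neqE_nat)

lemma incr_skip: "incr s n \<Longrightarrow> incr (s \<circ> skip i) (n - 1)"
  unfolding incr_def comp_def by (metis skip_less skip_strict_mono)

lemma incr_homothety: "incr s n \<Longrightarrow> homothety t \<Longrightarrow> incr (t \<circ> s) n"
  by (auto simp: incr_def homothety_less_iff)

lemma incr_unique:
  assumes "incr f m" "incr g m" "f ` {..<m} = g ` {..<m}" "l < m"
  shows "f l = g l"
proof -
  have sd: "sorted_wrt (<) (map h [0..<m])" if "incr h m" for h
    using that by (auto simp: incr_def sorted_wrt_iff_nth_less)
  have "map f [0..<m] = map g [0..<m]"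
    using sd[OF assms(1)] sd[OF assms(2)] assms(3)
    by (intro strict_sorted_equal) (simp_all add: atLeast0LessThan)
  then show ?thesis using assms(4) by (auto simp: map_eq_conv)
qed

text \<open>Equivalently, \<open>\<psi>\<close> maps the terms other than \<open>s j\<close>, in
  order, onto the terms other than \<open>s i\<close>. The image of \<open>s j\<close> is left
  open.\<close>

definition block_shift :: "(rat \<Rightarrow> rat) \<Rightarrow> (nat \<Rightarrow> rat) \<Rightarrow> nat \<Rightarrow> nat \<Rightarrow> nat \<Rightarrow> bool" where
  "block_shift \<psi> s n i j \<longleftrightarrow> homothety \<psi> \<and> i < j \<and> j < n \<and>
     (\<forall>l<n. l \<noteq> j \<longrightarrow> \<psi> (s l) = (if i \<le> l \<and> l < j then s (Suc l) else s l))"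

lemma block_shift_moves:
  "block_shift \<psi> s n i j \<Longrightarrow> i \<le> l \<Longrightarrow> l < j \<Longrightarrow> \<psi> (s l) = s (Suc l)"
  by (simp add: block_shift_def)

lemma block_shift_fixes:
  "block_shift \<psi> s n i j \<Longrightarrow> l < n \<Longrightarrow> l < i \<or> j < l \<Longrightarrow> \<psi> (s l) = s l"
  by (auto simp: block_shift_def)

text \<open>Terms outside the block are fixed, and two fixed points would make \<open>\<psi>\<close>
  the identity, although it moves \<open>s i\<close>.\<close>

lemma block_shift_large:
  assumes s: "incr s n" and b: "block_shift \<psi> s n i j"
  shows "i + (n - 1 - j) \<le> 1"
proof (rule ccontr)
  assume neg: "\<not> i + (n - 1 - j) \<le> 1"
  have ij: "i < j" "j < n" "homothety \<psi>" using b by (auto simp: block_shift_def)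
  obtain k l where kl: "k < l" "l < n" "k < i \<or> j < k" "l < i \<or> j < l"
  proof (cases "i = 0")
    case True
    then show ?thesis using that[of "j + 1" "j + 2"] neg ij by auto
  next
    case False
    then show ?thesis
      using that[of 0 1] that[of 0 "j + 1"] neg ij by (cases "i = 1") auto
  qed
  have id: "homothety (\<lambda>x. x)" unfolding homothety_def by (intro exI[of _ 1] exI[of _ 0]) auto
  have "\<psi> = (\<lambda>x. x)"
    by (rule homothety_eqI[of _ _ "s k" "s l"])
       (use kl b s ij id in \<open>auto simp: block_shift_fixes incr_eq_iff\<close>)
  moreover have "\<psi> (s i) = s (Suc i)" using b ij by (simp add: block_shift_moves)
  ultimately show False using ij s by (simp add: incr_eq_iff)
qed

text \<open>If \<open>\<psi>\<close> has ratio \<open>c\<close> and \<open>e = s 1 - s 0\<close>,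
  the successive gaps are \<open>e\<close>, \<open>c * e\<close> and
  \<open>(1 + c) * (c * e)\<close>. Since \<open>\<psi>\<close> also fixes \<open>s 3\<close>, this
  leads to \<open>c * c + c = 1\<close>.\<close>

lemma block_shift_golden:
  assumes s: "incr s 4" and "block_shift \<psi> s 4 0 2" "block_shift \<psi>' s 4 1 3"
  shows False
proof -
  have 1: "\<psi> (s 0) = s 1" "\<psi> (s 1) = s 2" "\<psi> (s 3) = s 3"
    using assms(2) block_shift_moves[of \<psi> s 4 0 2 0] block_shift_moves[of \<psi> s 4 0 2 1]
      block_shift_fixes[of \<psi> s 4 0 2 3] by (auto simp: numeral_eq_Suc)
  have 2: "\<psi>' (s 0) = s 0" "\<psi>' (s 1) = s 2" "\<psi>' (s 2) = s 3"
    using assms(3) block_shift_moves[of \<psi>' s 4 1 3 1] block_shift_moves[of \<psi>' s 4 1 3 2]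
      block_shift_fixes[of \<psi>' s 4 1 3 0] by (auto simp: numeral_eq_Suc)
  have "s 0 < s 1" using s by (simp add: incr_def)
  obtain c d where c: "0 < c" "\<psi> = (\<lambda>x. c * x + d)"
    using assms(2) by (auto simp: block_shift_def homothety_def)
  obtain c' d' where c': "\<psi>' = (\<lambda>x. c' * x + d')"
    using assms(3) by (auto simp: block_shift_def homothety_def)
  define e where "e = s 1 - s 0"
  have e: "e > 0" using \<open>s 0 < s 1\<close> by (simp add: e_def)
  have a: "s 2 - s 1 = c * e" "s 3 - s 2 = c * (s 3 - s 1)"
    using 1 c by (simp_all add: e_def algebra_simps)
  have b: "s 2 - s 0 = c' * e" "s 3 - s 2 = c' * (s 2 - s 1)"
    using 2 c' by (simp_all add: e_def algebra_simps)
  have "(1 + c) * e = c' * e" using a b by (simp add: e_def algebra_simps)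
  then have c'_eq: "c' = 1 + c" using e by simp
  have d: "s 3 - s 2 = (1 + c) * (c * e)" using b(2) a(1) c'_eq by simp
  have "s 3 - s 1 = (1 + c) * (c * e) + c * e" using d a(1) by linarith
  then have "(1 + c) * (c * e) = c * ((1 + c) * (c * e) + c * e)" using a(2) d by (simp only:)
  then have "(c * e) * (c * c + c - 1) = 0" by (simp add: algebra_simps)
  then have "c * c + c = 1" using c e by simp
  then show False using golden_ratio_irrational by blast
qed

text \<open>Two terms moved by both maps force \<open>\<psi> = \<psi>'\<close>, and then the set of
  moved terms determines the block. Too small an overlap leaves only the golden ratio case.\<close>

lemma block_shift_unique:
  assumes s: "incr s n" and n: "n \<ge> 4"
    and b: "block_shift \<psi> s n i j" and b': "block_shift \<psi>' s n i' j'"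
  shows "i = i' \<and> j = j'"
proof -
  note L = block_shift_large[OF s b] block_shift_large[OF s b']
  have ij: "i < j" "j < n" "homothety \<psi>" "i' < j'" "j' < n" "homothety \<psi>'"
    using b b' by (auto simp: block_shift_def)
  show ?thesis
  proof (cases "max i i' + 2 \<le> min j j'")
    case True
    define k where "k = max i i'"
    have k: "i \<le> k" "i' \<le> k" "Suc k < j" "Suc k < j'" using True by (auto simp: k_def)
    have eq: "\<psi> = \<psi>'"
    proof (rule homothety_eqI[of _ _ "s k" "s (Suc k)"])
      show "s k \<noteq> s (Suc k)" using s k ij by (simp add: incr_eq_iff)
    qed (use ij k b b' in \<open>simp_all add: block_shift_moves\<close>)
    have "i = i'"
    proof (rule ccontr)
      assume "i \<noteq> i'"
      then consider "i < i'" | "i' < i" by linarith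
      then show False
      proof cases
        case 1
        then have "\<psi> (s i) = s (Suc i)" "\<psi>' (s i) = s i"
          using b b' ij by (auto simp: block_shift_moves block_shift_fixes)
        then show False using eq s ij by (simp add: incr_eq_iff)
      next
        case 2
        then have "\<psi>' (s i') = s (Suc i')" "\<psi> (s i') = s i'"
          using b b' ij by (auto simp: block_shift_moves block_shift_fixes)
        then show False using eq s ij by (simp add: incr_eq_iff)
      qed
    qed
    \<comment> \<open>As the image of a block's last term is open, injectivity is used at the larger
      right end: that term and its predecessor would have the same image.\<close>
    moreover have "j = j'"
    proof (rule ccontr)
      assume "j \<noteq> j'"
      then consider "j < j'" | "j' < j" by linarith
      then show False
      proof cases
        case 1
        then have "\<psi>' (s (j' - 1)) = s j'" "\<psi> (s j') = s j'"
          using b b' ij block_shift_moves[OF b', of "j' - 1"]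
          by (auto simp: block_shift_fixes)
        then have "s (j' - 1) = s j'" using eq ij by (metis homothety_eq_iff)
        then show False using s ij by (simp add: incr_eq_iff)
      next
        case 2
        then have "\<psi> (s (j - 1)) = s j" "\<psi>' (s j) = s j"
          using b b' ij block_shift_moves[OF b, of "j - 1"]
          by (auto simp: block_shift_fixes)
        then have "s (j - 1) = s j" using eq ij by (metis homothety_eq_iff)
        then show False using s ij by (simp add: incr_eq_iff)
      qed
    qed
    ultimately show ?thesis ..
  next
    case False
    \<comment> \<open>Each block misses at most one term, so the overlap is this small only for the
      blocks 0 to 2 and 1 to 3 of four terms.\<close>
    then have "n = 4" and "(i, j, i', j') = (0, 2, 1, 3) \<or> (i, j, i', j') = (1, 3, 0, 2)"
      using L n ij by auto
    then show ?thesis using block_shift_golden s b b' by blast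
  qed
qed

section \<open>Completions of a set to a homothetic copy\<close>

text \<open>Deleting \<open>y\<close> and \<open>z\<close> from the two copies gives two increasing
  enumerations of \<open>A\<close>, which must agree term by term. If \<open>i = j\<close>, then
  \<open>t\<close> and \<open>u\<close> would agree at two points, whence
  \<open>y = z\<close>.\<close>

lemma common_part:
  assumes s: "incr s n" and n: "n \<ge> 3" and t: "homothety t" and u: "homothety u"
    and y: "t ` s ` {..<n} = insert y A" "y \<notin> A"
    and z: "u ` s ` {..<n} = insert z A" "z \<notin> A" and "y \<noteq> z"
  obtains i j where "i < n" "j < n" "i \<noteq> j" "y = t (s i)" "z = u (s j)"
    "A = t ` (s \<circ> skip i) ` {..<n - 1}" "A = u ` (s \<circ> skip j) ` {..<n - 1}"
    "\<And>l. l < n - 1 \<Longrightarrow> t (s (skip i l)) = u (s (skip j l))"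
proof -
  have removal: "\<exists>i<n. y = t (s i) \<and> A = t ` (s \<circ> skip i) ` {..<n - 1}"
    if t: "homothety t" and y: "t ` s ` {..<n} = insert y A" "y \<notin> A" for t y
  proof -
    obtain i where i: "i < n" "y = t (s i)" using y(1) by (auto simp: set_eq_iff image_iff)
    have "inj_on (\<lambda>l. t (s l)) {..<n}"
      using s t by (auto simp: inj_on_def homothety_eq_iff incr_eq_iff)
    then have "(\<lambda>l. t (s l)) ` ({..<n} - {i}) = (\<lambda>l. t (s l)) ` {..<n} - {y}"
      using i by (auto simp: inj_on_def)
    also have "\<dots> = A" using y by (auto simp: image_image)
    finally show ?thesis using i by (auto simp: skip_image[symmetric] image_image)
  qed
  obtain i where i: "i < n" "y = t (s i)" "A = t ` (s \<circ> skip i) ` {..<n - 1}"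
    using removal[OF t y] by blast
  obtain j where j: "j < n" "z = u (s j)" "A = u ` (s \<circ> skip j) ` {..<n - 1}"
    using removal[OF u z] by blast
  have eq: "t (s (skip i l)) = u (s (skip j l))" if "l < n - 1" for l
  proof -
    have "(t \<circ> (s \<circ> skip i)) l = (u \<circ> (s \<circ> skip j)) l"
    proof (rule incr_unique[OF _ _ _ that])
      show "(t \<circ> (s \<circ> skip i)) ` {..<n - 1} = (u \<circ> (s \<circ> skip j)) ` {..<n - 1}"
        using i(3) j(3) by (metis image_comp)
    qed (intro incr_homothety incr_skip s t u)+
    then show ?thesis by simp
  qed
  have "i \<noteq> j"
  proof
    assume "i = j"
    have "t = u"
    proof (rule homothety_eqI[OF t u])
      show "t (s (skip i 0)) = u (s (skip i 0))" "t (s (skip i 1)) = u (s (skip i 1))"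
        using eq[of 0] eq[of 1] n \<open>i = j\<close> by auto
      show "s (skip i 0) \<noteq> s (skip i 1)"
        using s n by (simp add: incr_eq_iff skip_less) (simp add: skip_def)
    qed
    then show False using \<open>y \<noteq> z\<close> i j \<open>i = j\<close> by simp
  qed
  then show ?thesis using that i j eq by blast
qed

text \<open>Take \<open>\<psi>\<close> to be the inverse of \<open>t\<close> composed with
  \<open>u\<close>: \<open>skip i\<close> and \<open>skip j\<close> differ exactly from position
  \<open>i\<close> to \<open>j - 1\<close>, and there by one.\<close>

lemma block_shift_of_common_part:
  assumes t: "homothety t" and u: "homothety u" and ij: "i < j" "j < n"
    and eq: "\<And>l. l < n - 1 \<Longrightarrow> t (s (skip i l)) = u (s (skip j l))"
  obtains \<psi> where "block_shift \<psi> s n i j" "\<And>x. t (\<psi> x) = u x"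
proof -
  obtain \<psi> where \<psi>: "homothety \<psi>" "\<And>x. t (\<psi> x) = u x" using homothety_factor t u by blast
  have "\<psi> (s l) = (if i \<le> l \<and> l < j then s (Suc l) else s l)" if l: "l < n" "l \<noteq> j" for l
  proof -
    have "t (\<psi> (s l)) = t (if i \<le> l \<and> l < j then s (Suc l) else s l)"
    proof (cases "l < j")
      case True
      then show ?thesis using eq[of l] ij \<psi>(2) by (auto simp: skip_def)
    next
      case False
      then obtain k where k: "l = Suc k" "j \<le> k" using l by (cases l) auto
      then have "u (s l) = t (s l)" using eq[of k] ij l by (simp add: skip_def)
      then show ?thesis using False \<psi>(2) by simp
    qed
    then show ?thesis using t by (simp add: homothety_eq_iff)
  qed
  then have "block_shift \<psi> s n i j" using \<psi>(1) ij unfolding block_shift_def by blast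
  then show ?thesis using that \<psi>(2) by blast
qed

text \<open>Deleting the first term of the block leaves a block shift under the same
  \<open>\<psi>\<close>. This makes uniqueness applicable to the \<open>n - 1\<close> points of
  \<open>A\<close> themselves.\<close>

lemma block_shift_skip:
  assumes "block_shift \<psi> s n i j" "Suc i < j"
  shows "block_shift \<psi> (s \<circ> skip i) (n - 1) i (j - 1)"
proof -
  have "\<psi> ((s \<circ> skip i) l) =
      (if i \<le> l \<and> l < j - 1 then (s \<circ> skip i) (Suc l) else (s \<circ> skip i) l)"
    if l: "l < n - 1" "l \<noteq> j - 1" for l
  proof -
    consider "l < i" | "i \<le> l" "Suc l < j" "l < j - 1" | "i \<le> l" "j < Suc l" "\<not> l < j - 1"
      using l assms(2) by linarith
    then show ?thesis
      using block_shift_moves[OF assms(1), of "Suc l"] block_shift_fixes[OF assms(1), of l]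
        block_shift_fixes[OF assms(1), of "Suc l"] l
      by cases (simp_all add: skip_def)
  qed
  moreover have "homothety \<psi>" "i < j - 1" "j - 1 < n - 1"
    using assms by (auto simp: block_shift_def)
  ultimately show ?thesis unfolding block_shift_def by blast
qed

text \<open>The roles of \<open>t\<close> and \<open>u\<close> are swapped if necessary to get
  \<open>i < j\<close>; hence \<open>y\<close> and \<open>z\<close> are recovered only as an
  unordered pair.\<close>

lemma two_completions:
  assumes s: "incr s n" and n: "n \<ge> 3"
    and t: "homothety t" "t ` s ` {..<n} = insert y A" "y \<notin> A"
    and u: "homothety u" "u ` s ` {..<n} = insert z A" "z \<notin> A" and "y \<noteq> z"
  obtains t' u' \<psi> i j where "homothety t'" "homothety u'" "block_shift \<psi> s n i j"
    "\<And>x. t' (\<psi> x) = u' x" "A = t' ` (s \<circ> skip i) ` {..<n - 1}" "{y, z} = {t' (s i), u' (s j)}"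
proof -
  obtain i j where ij: "i < n" "j < n" "i \<noteq> j" "y = t (s i)" "z = u (s j)"
    "A = t ` (s \<circ> skip i) ` {..<n - 1}" "A = u ` (s \<circ> skip j) ` {..<n - 1}"
    "\<And>l. l < n - 1 \<Longrightarrow> t (s (skip i l)) = u (s (skip j l))"
    using common_part[OF s n t(1) u(1) t(2,3) u(2,3) \<open>y \<noteq> z\<close>] by blast
  show ?thesis
  proof (cases "i < j")
    case True
    obtain \<psi> where "block_shift \<psi> s n i j" "\<And>x. t (\<psi> x) = u x"
      using block_shift_of_common_part[where s = s, OF t(1) u(1) True ij(2) ij(8)] by blast
    then show ?thesis using that t u ij by blast
  next
    case False
    then have "j < i" using ij by simp
    obtain \<psi> where "block_shift \<psi> s n j i" "\<And>x. u (\<psi> x) = t x"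
      using block_shift_of_common_part[where s = s, OF u(1) t(1) \<open>j < i\<close> ij(1) ij(8)[symmetric]]
      by blast
    moreover have "{y, z} = {u (s j), t (s i)}" using ij by auto
    ultimately show ?thesis using that t u ij by blast
  qed
qed

section \<open>Double threats and how their centres are related\<close>

definition rat_copy :: "(nat \<Rightarrow> rat) \<Rightarrow> nat \<Rightarrow> rat set \<Rightarrow> bool" where
  "rat_copy s n X \<longleftrightarrow> (\<exists>t. homothety t \<and> t ` s ` {..<n} = X)"

definition fork :: "(rat set \<Rightarrow> bool) \<Rightarrow> rat set \<Rightarrow> rat \<Rightarrow> rat \<Rightarrow> rat \<Rightarrow> bool" where
  "fork P M x y z \<longleftrightarrow> x \<notin> M \<and> y \<notin> insert x M \<and> z \<notin> insert x M \<and> y \<noteq> z \<and>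
     P (insert y (insert x M)) \<and> P (insert z (insert x M))"

lemma fork_homotheties:
  assumes s: "incr s n" and n: "n \<ge> 3" and "fork (rat_copy s n) M x y z"
  obtains t u \<psi> i j where "homothety t" "homothety u" "block_shift \<psi> s n i j"
    "\<And>x. t (\<psi> x) = u x" "insert x M = t ` (s \<circ> skip i) ` {..<n - 1}"
    "{y, z} = {t (s i), u (s j)}"
proof -
  have f: "y \<notin> insert x M" "z \<notin> insert x M" "y \<noteq> z"
    and copies: "rat_copy s n (insert y (insert x M))" "rat_copy s n (insert z (insert x M))"
    using assms(3) unfolding fork_def by simp_all
  obtain t where t: "homothety t" "t ` s ` {..<n} = insert y (insert x M)"
    using copies(1) unfolding rat_copy_def by (elim exE conjE)
  obtain u where u: "homothety u" "u ` s ` {..<n} = insert z (insert x M)"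
    using copies(2) unfolding rat_copy_def by (elim exE conjE)
  show ?thesis by (rule two_completions[OF s n t f(1) u f(2,3) that])
qed

text \<open>By uniqueness both forks shift the same block of \<open>s\<close>, so
  \<open>insert x M\<close> and \<open>insert x' M\<close> are images of one sequence
  \<open>r\<close> under \<open>t\<close> and \<open>t'\<close>. They share \<open>M\<close>, so
  \<open>t\<close> and \<open>t'\<close> differ by a block shift of \<open>r\<close>; uniqueness for
  its \<open>n - 1 \<ge> 4\<close> terms identifies that block with the one shifted by
  \<open>\<psi>\<close>. Hence \<open>t' = u\<close> or \<open>t = u'\<close>, which makes
  \<open>x\<close> a completion in the other fork.\<close>

lemma fork_centres_adjacent:
  assumes s: "incr s n" and n: "n \<ge> 5"
    and f: "fork (rat_copy s n) M x y z" and f': "fork (rat_copy s n) M x' y' z'"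
  shows "x \<in> {x', y', z'}"
proof (cases "x = x'")
  case False
  have n3: "n \<ge> 3" "n - 1 \<ge> 3" using n by auto
  obtain t u \<psi> i j where 1: "homothety t" "homothety u" "block_shift \<psi> s n i j"
    "\<And>x. t (\<psi> x) = u x" "insert x M = t ` (s \<circ> skip i) ` {..<n - 1}" "{y, z} = {t (s i), u (s j)}"
    using fork_homotheties[OF s n3(1) f] by blast
  obtain t' u' \<psi>' i' j' where 2: "homothety t'" "homothety u'" "block_shift \<psi>' s n i' j'"
    "\<And>x. t' (\<psi>' x) = u' x" "insert x' M = t' ` (s \<circ> skip i') ` {..<n - 1}"
    "{y', z'} = {t' (s i'), u' (s j')}"
    using fork_homotheties[OF s n3(1) f'] by blast
  have [simp]: "i' = i" "j' = j"
    using block_shift_unique[OF s _ 1(3) 2(3)] n by auto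
  \<comment> \<open>At least four terms lie in the block, so the indices \<open>i + 1\<close> and
    \<open>i + 2\<close> are both below \<open>j\<close>; two homotheties are compared there
    below.\<close>
  have long: "i + 3 \<le> j" "j < n"
    using block_shift_large[OF s 1(3)] 1(3) n by (auto simp: block_shift_def)
  define r where "r = s \<circ> skip i"
  have r: "incr r (n - 1)" using s unfolding r_def by (rule incr_skip)
  have r_shift: "block_shift \<psi> r (n - 1) i (j - 1)"
    using block_shift_skip[OF 1(3)] long by (simp add: r_def)
  have r_eq: "r l = s (Suc l)" if "i \<le> l" for l using that by (simp add: r_def skip_def)
  have x: "x \<notin> M" "x' \<notin> M" using f f' by (auto simp: fork_def)
  have u_eq: "u (s l) = t (s (Suc l))" "u' (s l) = t' (s (Suc l))" if "i \<le> l" "l < j" for l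
    using that 1(3,4) 2(3,4) block_shift_moves by (metis \<open>i' = i\<close> \<open>j' = j\<close>)+
  have distinct: "s (Suc i) \<noteq> s (Suc (Suc i))" using s long by (simp add: incr_eq_iff)
  obtain p q where pq: "p < n - 1" "q < n - 1" "p \<noteq> q" "x = t (r p)" "x' = t' (r q)"
    "\<And>l. l < n - 1 - 1 \<Longrightarrow> t (r (skip p l)) = t' (r (skip q l))"
    using common_part[OF r n3(2) 1(1) 2(1) 1(5)[folded r_def, symmetric] x(1)
        2(5)[unfolded \<open>i' = i\<close>, folded r_def, symmetric] x(2) False] by blast
  show ?thesis
  proof (cases "p < q")
    case True
    obtain \<eta> where \<eta>: "block_shift \<eta> r (n - 1) p q"
      using block_shift_of_common_part[where s = r, OF 1(1) 2(1) True pq(2) pq(6)] by blast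
    have "p = i" "q = j - 1" using block_shift_unique[OF r _ \<eta> r_shift] n by auto
    then have "t (r (Suc l)) = t' (r l)" if "i \<le> l" "l < j - 1" for l
      using pq(6)[of l] that long by (simp add: skip_def)
    then have t': "t (s (Suc (Suc l))) = t' (s (Suc l))" if "i \<le> l" "l < j - 1" for l
      using that by (simp add: r_eq)
    have "u = t'"
    proof (rule homothety_eqI[OF 1(2) 2(1) _ _ distinct])
      show "u (s (Suc i)) = t' (s (Suc i))" "u (s (Suc (Suc i))) = t' (s (Suc (Suc i)))"
        using t'[of i] t'[of "Suc i"] u_eq long by auto
    qed
    then have "x = t' (s i)" using pq(4) \<open>p = i\<close> u_eq(1)[of i] long by (simp add: r_eq)
    then show ?thesis using 2(6) by auto
  next
    case False
    then have "q < p" using pq by simp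
    obtain \<eta> where \<eta>: "block_shift \<eta> r (n - 1) q p"
      using block_shift_of_common_part[where s = r, OF 2(1) 1(1) \<open>q < p\<close> pq(1) pq(6)[symmetric]]
      by blast
    have qp: "q = i" "p = j - 1" using block_shift_unique[OF r _ \<eta> r_shift] n by auto
    then have "t' (r (Suc l)) = t (r l)" if "i \<le> l" "l < j - 1" for l
      using pq(6)[of l] that long by (simp add: skip_def)
    then have t': "t' (s (Suc (Suc l))) = t (s (Suc l))" if "i \<le> l" "l < j - 1" for l
      using that by (simp add: r_eq)
    have "u' = t"
    proof (rule homothety_eqI[OF 2(2) 1(1) _ _ distinct])
      show "u' (s (Suc i)) = t (s (Suc i))" "u' (s (Suc (Suc i))) = t (s (Suc (Suc i)))"
        using t'[of i] t'[of "Suc i"] u_eq long by auto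
    qed
    then have "x = u' (s j)" using pq(4) qp long by (simp add: r_eq)
    then show ?thesis using 2(6) by auto
  qed
qed simp

section \<open>Breaker's play\<close>

text \<open>A copy of \<open>S\<close> has \<open>n\<close> elements, so it fills the
  \<open>n\<close>-element set \<open>X\<close>: no choice of Maker is wasted.\<close>

lemma contains_copy_rat_copy:
  assumes "finite S" "card S = n" "finite X" "card X = n" "contains_copy S X"
    and s: "s = (\<lambda>l. of_nat (sorted_list_of_set S ! l))"
  shows "rat_copy s n (of_nat ` X)"
proof -
  obtain a b where ab: "a \<noteq> 0" "homothetic_copy S a b \<subseteq> int ` X"
    using assms by (auto simp: contains_copy_def)
  have "card (homothetic_copy S a b) = n"
    using ab assms(2) unfolding homothetic_copy_def by (subst card_image) (auto simp: inj_on_def)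
  moreover have "card (int ` X) = n" using assms by (simp add: card_image)
  ultimately have eq: "homothetic_copy S a b = int ` X"
    using ab assms by (intro card_subset_eq) auto
  let ?t = "\<lambda>x :: rat. of_nat a * x + of_int b"
  have S: "(!) (sorted_list_of_set S) ` {..<n} = S"
    using assms nth_image[of n "sorted_list_of_set S"] by (simp add: lessThan_atLeast0)
  have "s ` {..<n} = of_nat ` S"
    unfolding s by (subst S[symmetric]) (simp only: image_image)
  then have "?t ` s ` {..<n} = of_int ` homothetic_copy S a b"
    by (simp add: homothetic_copy_def image_image)
  also have "\<dots> = of_nat ` X" by (simp add: eq image_image)
  finally have "?t ` s ` {..<n} = of_nat ` X" .
  moreover have "homothety ?t"
    unfolding homothety_def using ab by (intro exI[of _ "of_nat a"] exI[of _ "of_int b"]) auto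
  ultimately show ?thesis unfolding rat_copy_def by blast
qed

lemma incr_sorted_list_of_set:
  assumes "card S = n"
  shows "incr (\<lambda>l. of_nat (sorted_list_of_set S ! l)) n"
  using assms sorted_wrt_nth_less[OF strict_sorted_list_of_set, of _ _ S]
  by (auto simp: incr_def)

text \<open>\<open>Q M y\<close> expresses that, facing Maker's set \<open>M\<close>, Breaker would like to take \<open>y\<close>.\<close>

lemma breaker_play:
  fixes Q :: "nat set \<Rightarrow> nat \<Rightarrow> bool"
  assumes \<sigma>: "maker_strategy \<sigma>"
  obtains p where "legal_play p" "follows \<sigma> p"
    "\<And>k y. Q (maker_choices p (Suc k)) y \<Longrightarrow> y \<notin> p ` {..<2 * k + 1} \<Longrightarrow>
       Q (maker_choices p (Suc k)) (p (2 * k + 1))"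
proof -
  \<comment> \<open>Entries at even places of a history are Maker's. Breaker takes a fresh number
    satisfying \<open>Q\<close> if there is one, and any fresh number otherwise.\<close>
  define good where "good h y \<longleftrightarrow> y \<notin> set h \<and>
    ((\<exists>y. y \<notin> set h \<and> Q (set (nths h {i. even i})) y) \<longrightarrow> Q (set (nths h {i. even i})) y)"
    for h y
  define move where "move h = (if even (length h) then \<sigma> h else (SOME y. good h y))" for h
  have "\<exists>y. good h y" for h
    using ex_new_if_finite[of "set h"] infinite_UNIV_nat unfolding good_def by (metis finite_set)
  then have good: "good h (SOME y. good h y)" for h by (rule someI_ex)
  have fresh: "move h \<notin> set h" for h
    using \<sigma> good[of h] by (auto simp: move_def maker_strategy_def good_def)
  define hist where "hist = rec_nat [] (\<lambda>_ h. h @ [move h])"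
  define p where "p i = move (hist i)" for i
  have hist: "hist i = map p [0..<i]" for i
    by (induction i) (simp_all add: hist_def p_def)
  have p: "p i = move (map p [0..<i])" for i by (simp add: p_def hist[symmetric])
  have evens: "set (nths (map p [0..<2 * k + 1]) {i. even i}) = maker_choices p (Suc k)" for k
    unfolding maker_choices_def set_nths
  proof (intro set_eqI iffI)
    fix v assume "v \<in> {map p [0..<2 * k + 1] ! i |i.
      i < length (map p [0..<2 * k + 1]) \<and> i \<in> {i. even i}}"
    then obtain i where "i < 2 * k + 1" "even i" "v = p i" by (auto simp del: upt_Suc)
    then show "v \<in> (\<lambda>k. p (2 * k)) ` {..<Suc k}" by (auto elim!: evenE)
  next
    fix v assume "v \<in> (\<lambda>k. p (2 * k)) ` {..<Suc k}"
    then obtain l where "l < Suc k" "v = p (2 * l)" by auto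
    then show "v \<in> {map p [0..<2 * k + 1] ! i |i.
      i < length (map p [0..<2 * k + 1]) \<and> i \<in> {i. even i}}"
      by (auto simp del: upt_Suc intro!: exI[of _ "2 * l"])
  qed
  show ?thesis
  proof
    show "legal_play p"
      unfolding legal_play_def
    proof
      fix i show "p i \<notin> p ` {..<i}"
        using fresh[of "map p [0..<i]"] p[of i] by (simp add: lessThan_atLeast0)
    qed
    show "follows \<sigma> p"
      unfolding follows_def by (metis p move_def length_map length_upt diff_zero dvd_triv_left)
    fix k y assume y: "Q (maker_choices p (Suc k)) y" "y \<notin> p ` {..<2 * k + 1}"
    have "good (map p [0..<2 * k + 1]) (p (2 * k + 1))"
      using good[of "map p [0..<2 * k + 1]"] p[of "2 * k + 1"] by (simp add: move_def del: upt_Suc)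
    then show "Q (maker_choices p (Suc k)) (p (2 * k + 1))"
      using y evens[of k] unfolding good_def by (auto simp: lessThan_atLeast0 simp del: upt_Suc)
  qed
qed

section \<open>Two replies of Breaker that refute an \<open>n\<close>-move strategy\<close>

theorem theorem3p11:
  fixes S :: "nat set" and n :: nat
  assumes "finite S" and "card S = n" and "n \<ge> 5"
  shows "\<not> maker_has_move_strategy S n"
proof
  assume "maker_has_move_strategy S n"
  then obtain \<sigma> where \<sigma>: "maker_strategy \<sigma>"
    and win: "\<And>p. legal_play p \<Longrightarrow> follows \<sigma> p \<Longrightarrow> \<exists>m\<le>n. contains_copy S (maker_choices p m)"
    by (auto simp: maker_has_move_strategy_def)
  define s :: "nat \<Rightarrow> rat" where "s = (\<lambda>l. of_nat (sorted_list_of_set S ! l))"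
  have s: "incr s n" using incr_sorted_list_of_set[OF assms(2)] by (simp add: s_def)
  define forked where "forked M x y z \<longleftrightarrow>
    fork (rat_copy s n) (of_nat ` M) (of_nat x) (of_nat y) (of_nat z)" for M :: "nat set" and x y z :: nat
  \<comment> \<open>Against \<open>n - 2\<close> points Breaker wants a number that belongs to every
    fork; against \<open>n - 1\<close> points, a completion.\<close>
  define Q where "Q M v \<longleftrightarrow> (if card M = n - 2 then \<forall>x y z. forked M x y z \<longrightarrow> v \<in> {x, y, z}
    else rat_copy s n (of_nat ` insert v M))" for M :: "nat set" and v :: nat
  obtain p where p: "legal_play p" "follows \<sigma> p"
    and Q: "\<And>k y. Q (maker_choices p (Suc k)) y \<Longrightarrow> y \<notin> p ` {..<2 * k + 1} \<Longrightarrow>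
       Q (maker_choices p (Suc k)) (p (2 * k + 1))"
    using breaker_play[OF \<sigma>] by blast
  have p_eq: "p a = p b \<longleftrightarrow> a = b" for a b
    using p(1) unfolding legal_play_def by (metis imageI lessThan_iff linorder_neqE_nat)
  have card_M: "card (maker_choices p k) = k" for k
    unfolding maker_choices_def by (subst card_image) (auto simp: inj_on_def p_eq)
  have in_M: "p i \<in> maker_choices p k \<longleftrightarrow> even i \<and> i < 2 * k" for i k
    by (auto simp: maker_choices_def p_eq)
  have M_Suc: "maker_choices p (Suc k) = insert (p (2 * k)) (maker_choices p k)" for k
    by (auto simp: maker_choices_def lessThan_Suc)
  \<comment> \<open>\<open>M\<close> holds Maker's first \<open>n - 2 = m + 1\<close> choices. Then
    follow Breaker's \<open>p (2 * m + 1)\<close>, Maker's \<open>x\<close>, Breaker's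
    \<open>v\<close> and Maker's last choice \<open>y\<close>.\<close>
  obtain m where m: "n = m + 3" "m \<ge> 2" using assms(3) that[of "n - 3"] by auto
  define M where "M = maker_choices p (m + 1)"
  define x where "x = p (2 * m + 2)"
  define y where "y = p (2 * m + 4)"
  define v where "v = p (2 * m + 3)"
  have M2: "maker_choices p (m + 2) = insert x M"
    using M_Suc[of "m + 1"] by (simp add: x_def M_def)
  have M3: "maker_choices p n = insert y (insert x M)"
    using M_Suc[of "m + 2"] M2 by (simp add: y_def m eval_nat_numeral)
  have "contains_copy S (maker_choices p n)"
  proof -
    obtain k where k: "k \<le> n" "contains_copy S (maker_choices p k)" using win p by blast
    moreover have "maker_choices p k \<subseteq> maker_choices p n"
      using k by (auto simp: maker_choices_def)
    ultimately show ?thesis unfolding contains_copy_def by (meson image_mono subset_trans)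
  qed
  then have y_copy: "rat_copy s n (of_nat ` insert y (insert x M))"
    using contains_copy_rat_copy[OF assms(1,2) _ card_M[of n] _ s_def] M3
    by (simp add: maker_choices_def)
  \<comment> \<open>The number \<open>y\<close> was still free when Breaker chose \<open>v\<close>,
    so a completion was available and \<open>v\<close> is one too.\<close>
  have "Q (insert x M) y" using y_copy card_M[of "m + 2"] M2 m by (simp add: Q_def)
  moreover have "y \<notin> p ` {..<2 * m + 3}" by (auto simp: y_def p_eq)
  moreover have idx: "Suc (m + 1) = m + 2" "2 * (m + 1) + 1 = 2 * m + 3" by simp_all
  ultimately have "Q (insert x M) v"
    using Q[of "m + 1" y, unfolded idx M2] by (simp add: v_def)
  then have v_copy: "rat_copy s n (of_nat ` insert v (insert x M))"
    using card_M[of "m + 2"] M2 m by (simp add: Q_def)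
  have "x \<notin> M" "y \<notin> insert x M" "v \<notin> insert x M" "y \<noteq> v"
    by (auto simp: x_def y_def v_def M_def in_M p_eq)
  then have fork: "forked M x y v"
    using y_copy v_copy by (auto simp: forked_def fork_def image_iff)
  \<comment> \<open>The centre \<open>x\<close> of one fork lies in every fork, so Breaker's
    previous reply could meet them all, and did.\<close>
  then have "Q M x"
    using card_M[of "m + 1"] m fork_centres_adjacent[OF s assms(3)]
    by (auto simp: Q_def M_def forked_def) (metis insertE of_nat_eq_iff singletonD)
  moreover have "x \<notin> p ` {..<2 * m + 1}" by (auto simp: x_def p_eq)
  ultimately have "Q M (p (2 * m + 1))" using Q[of m x] by (simp add: M_def)
  \<comment> \<open>But \<open>x\<close>, \<open>v\<close> and \<open>y\<close> are all chosen after
    this reply.\<close>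
  then have "p (2 * m + 1) \<in> {x, y, v}"
    using card_M[of "m + 1"] m fork by (simp add: Q_def M_def)
  then show False by (auto simp: x_def y_def v_def p_eq)
qed

end
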